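(* Let $X$ be a finite set with at least two elements, and let $\succsim$ and $\trianglerighteq$ be distinct acyclic orders on $X$ with the same symmetric parts. Then $\succsim$ can be transformed into $\trianglerighteq$ by finitely many one-step perturbations; that is, there exist a positive integer $n$ and acyclic orders $\succsim_0,\dots,\succsim_{n-1}$ on $X$ such that $\succsim\,\rightarrow\,\succsim_0\,\twoheadrightarrow\,\trianglerighteq$, $\succsim_{k-1}\,\rightarrow\,\succsim_k\,\twoheadrightarrow\,\trianglerighteq$ for each $k=1,\dots,n-1$, and $\succsim_{n-1}=\trianglerighteq$.
   Context: A binary relation on $X$ is a nonempty subset $R\subseteq X\times X$; write $x\,R\,y$ for $(x,y)\in R$. The asymmetric part $R^>$ of $R$ is defined by $x\,R^>\,y$ iff $x\,R\,y$ and not $y\,R\,x$; the symmetric part of $R$ is $R\setminus R^>$. $\mathrm{Inc}(R)$ is the set of all $(x,y)\in X\times X$ such that neither $x\,R\,y$ nor $y\,R\,x$. $R$ is acyclic if there are no pairwise distinct $z_1,\dots,z_k\in X$ with $z_1\,R^>\,z_2\,R^>\cdots R^>\,z_k\,R^>\,z_1$. An acyclic order on $X$ is a reflexive acyclic binary relation on $X$. For an acyclic order $\succsim$ (resp. $\trianglerighteq$), $\succ$ (resp. $\vartriangleright$) denotes its asymmetric part and $\sim$ its symmetric part. Perturbations: let $\succsim$ be an acyclic order and $a\neq b$ in $X$. If neither $a\succ b$ nor $b\succ a$, put $R:=\succsim\cup\{(a,b)\}$ if $(a,b)\in\mathrm{Inc}(\succsim)$, and $R:=\succsim\setminus\{(b,a)\}$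 if $a\sim b$; if this $R$ is acyclic, define $\succsim\oplus(a,b):=R$ (otherwise $\succsim\oplus(a,b)$ is undefined). If $a\succ b$, define $\succsim\ominus(a,b):=\succsim\setminus\{(a,b)\}$. For acyclic orders $\succsim,\succsim_0,\trianglerighteq$, we say $\succsim_0$ is a one-step perturbation of $\succsim$ toward $\trianglerighteq$, written $\succsim\,\rightarrow\,\succsim_0\,\twoheadrightarrow\,\trianglerighteq$, if either (i) there are $a,b$ with $a\succ b$, $\succsim_0=\succsim\ominus(a,b)$, not $a\vartriangleright b$, and $x\succ b$ for every $x\in X$ with $x\vartriangleright b$; or (ii) there are distinct $a,b$ with $(a,b)\in\mathrm{Inc}(\succ)$ such that $\succsim\oplus(a,b)$ is defined, $\succsim_0=\succsim\oplus(a,b)$, and $a\vartriangleright b$. *)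

theory Defs
  imports Main
begin

definition binary_relation_on :: "'a set \<Rightarrow> 'a rel \<Rightarrow> bool" where
  "binary_relation_on X R \<longleftrightarrow> R \<noteq> {} \<and> R \<subseteq> X \<times> X"

definition asym_part :: "'a rel \<Rightarrow> 'a rel" where
  "asym_part R = {(x, y). (x, y) \<in> R \<and> (y, x) \<notin> R}"

definition sym_part :: "'a rel \<Rightarrow> 'a rel" where
  "sym_part R = R - asym_part R"

definition Inc :: "'a set \<Rightarrow> 'a rel \<Rightarrow> 'a rel" where
  "Inc X R = {(x, y) \<in> X \<times> X. (x, y) \<notin> R \<and> (y, x) \<notin> R}"

text \<open>Acyclicity of the asymmetric part: no nonempty list of pairwise distinct points
  \<open>z\<^sub>1, \<dots>, z\<^sub>k\<close> of \<open>X\<close> forms a cycle. This is not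
  the library predicate \<^const>\<open>acyclic\<close> for \<open>R\<close> itself, which a reflexive
  relation on a nonempty set never satisfies.\<close>
definition acyclic_rel_on :: "'a set \<Rightarrow> 'a rel \<Rightarrow> bool" where
  "acyclic_rel_on X R \<longleftrightarrow>
     \<not> (\<exists>zs. zs \<noteq> [] \<and> set zs \<subseteq> X \<and> distinct zs \<and>
          successively (\<lambda>x y. (x, y) \<in> asym_part R) zs \<and>
          (last zs, hd zs) \<in> asym_part R)"

definition acyclic_order_on :: "'a set \<Rightarrow> 'a rel \<Rightarrow> bool" where
  "acyclic_order_on X R \<longleftrightarrow> binary_relation_on X R \<and> refl_on X R \<and> acyclic_rel_on X R"

definition oplus_candidate :: "'a set \<Rightarrow> 'a rel \<Rightarrow> 'a \<Rightarrow> 'a \<Rightarrow> 'a rel" where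
  "oplus_candidate X R a b = (if (a, b) \<in> Inc X R then R \<union> {(a, b)} else R - {(b, a)})"

text \<open>The partial operation \<open>R \<oplus> (a, b)\<close>, with \<^const>\<open>None\<close> for ``undefined''. If the
  first condition below holds and \<open>(a, b) \<notin> Inc X R\<close>, then \<open>(a, b) \<in> sym_part R\<close>, which is
  the second case of \<^const>\<open>oplus_candidate\<close>.\<close>
definition oplus :: "'a set \<Rightarrow> 'a rel \<Rightarrow> 'a \<Rightarrow> 'a \<Rightarrow> 'a rel option" where
  "oplus X R a b =
     (if a \<in> X \<and> b \<in> X \<and> a \<noteq> b \<and> (a, b) \<notin> asym_part R \<and> (b, a) \<notin> asym_part R \<and>
         acyclic_rel_on X (oplus_candidate X R a b)
      then Some (oplus_candidate X R a b) else None)"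

text \<open>Only meaningful for \<open>(a, b) \<in> asym_part R\<close>; every use below carries this condition.\<close>
definition ominus :: "'a rel \<Rightarrow> 'a \<Rightarrow> 'a \<Rightarrow> 'a rel" where
  "ominus R a b = R - {(a, b)}"

text \<open>\<open>one_step X R R\<^sub>0 T\<close>: \<open>R\<^sub>0\<close> is a one-step perturbation of \<open>R\<close> toward \<open>T\<close>,
  for acyclic orders \<open>R\<close>, \<open>R\<^sub>0\<close>, \<open>T\<close> on \<open>X\<close>. Incomparability in the second case is with
  respect to the asymmetric part of \<open>R\<close>, so it allows \<open>(a, b) \<in> sym_part R\<close>.\<close>
definition one_step :: "'a set \<Rightarrow> 'a rel \<Rightarrow> 'a rel \<Rightarrow> 'a rel \<Rightarrow> bool" where
  "one_step X R R\<^sub>0 T \<longleftrightarrow>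
     (\<exists>a\<in>X. \<exists>b\<in>X. (a, b) \<in> asym_part R \<and> R\<^sub>0 = ominus R a b \<and> (a, b) \<notin> asym_part T \<and>
        (\<forall>x\<in>X. (x, b) \<in> asym_part T \<longrightarrow> (x, b) \<in> asym_part R)) \<or>
     (\<exists>a\<in>X. \<exists>b\<in>X. a \<noteq> b \<and> (a, b) \<in> Inc X (asym_part R) \<and> oplus X R a b = Some R\<^sub>0 \<and>
        (a, b) \<in> asym_part T)"

end

theory Submission
  imports Defs
begin

text \<open>Among the points whose predecessors under the asymmetric parts of \<open>R\<close> and \<open>T\<close> differ, take
  \<open>b\<close> minimal with respect to \<open>T\<close>. If every \<open>T\<close>-predecessor of \<open>b\<close> is an \<open>R\<close>-predecessor,
  some \<open>R\<close>-predecessor of \<open>b\<close> that is not a \<open>T\<close>-predecessor may be deleted. Otherwise some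
  \<open>T\<close>-predecessor \<open>a\<close> of \<open>b\<close> may be added: below \<open>a\<close> the two relations agree, so an \<open>R\<close>-path
  from \<open>b\<close> to \<open>a\<close> would close up to a \<open>T\<close>-cycle. Either step shrinks the symmetric difference
  of \<open>R\<close> and \<open>T\<close>.\<close>

text \<open>Built by appending one point at a time: if the new endpoint already lies on the path,
  the path is cut at that occurrence, which keeps the points distinct.\<close>

lemma rtrancl_distinct_path:
  assumes "(x, y) \<in> P\<^sup>*"
  shows "\<exists>zs. zs \<noteq> [] \<and> distinct zs \<and> successively (\<lambda>u v. (u, v) \<in> P) zs \<and> hd zs = x \<and> last zs = y"
  using assms
proof (induction rule: rtrancl_induct)
  case base
  show ?case by (rule exI[of _ "[x]"]) simp
next
  case (step y z)
  then obtain zs where zs: "zs \<noteq> []" "distinct zs" "successively (\<lambda>u v. (u, v) \<in> P) zs"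
    "hd zs = x" "last zs = y" by blast
  show ?case
  proof (cases "z \<in> set zs")
    case True
    then obtain us vs where "zs = us @ z # vs" by (meson split_list)
    with zs show ?thesis
      by (intro exI[of _ "us @ [z]"]) (auto simp: successively_append_iff hd_append split: if_splits)
  next
    case False
    with zs step.hyps(2) show ?thesis
      by (intro exI[of _ "zs @ [z]"]) (auto simp: successively_append_iff)
  qed
qed

lemma successively_rtrancl:
  assumes "zs \<noteq> []" "successively (\<lambda>u v. (u, v) \<in> P) zs"
  shows "(hd zs, last zs) \<in> P\<^sup>*"
  using assms
proof (induction zs rule: list_nonempty_induct)
  case (cons x xs)
  then show ?case
    by (auto simp: successively_Cons intro: converse_rtrancl_into_rtrancl)
qed simp

text \<open>Gives access to the library facts on \<open>acyclic\<close>. A closed walk contains a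
  cycle through distinct points, and \<open>R \<subseteq> X \<times> X\<close> keeps these points in
  \<open>X\<close>.\<close>

lemma acyclic_rel_on_iff:
  assumes "R \<subseteq> X \<times> X"
  shows "acyclic_rel_on X R \<longleftrightarrow> acyclic (asym_part R)"
proof
  assume *: "acyclic (asym_part R)"
  show "acyclic_rel_on X R"
    unfolding acyclic_rel_on_def
    using successively_rtrancl[of _ "asym_part R"] *
    by (meson acyclic_def rtrancl_into_trancl1)
next
  assume *: "acyclic_rel_on X R"
  show "acyclic (asym_part R)"
  proof (rule ccontr)
    assume "\<not> acyclic (asym_part R)"
    then obtain x where "(x, x) \<in> (asym_part R)\<^sup>+" by (auto simp: acyclic_def)
    then obtain y where y: "(x, y) \<in> (asym_part R)\<^sup>*" "(y, x) \<in> asym_part R"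
      by (meson tranclD2)
    obtain zs where zs: "zs \<noteq> []" "distinct zs"
      "successively (\<lambda>u v. (u, v) \<in> asym_part R) zs" "hd zs = x" "last zs = y"
      using rtrancl_distinct_path[OF y(1)] by blast
    \<comment> \<open>Every point of the cycle is the target of an edge: the first one of the
      closing edge \<open>(y, x)\<close>, any other of the edge from its predecessor in
      \<open>zs\<close>.\<close>
    have "set zs \<subseteq> X"
    proof
      fix z assume "z \<in> set zs"
      then obtain us vs where "zs = us @ z # vs" by (meson split_list)
      then show "z \<in> X"
        using zs y(2) assms
        by (cases us rule: rev_cases)
           (auto simp: successively_append_iff asym_part_def)
    qed
    with * zs y(2) show False unfolding acyclic_rel_on_def by blast
  qed
qed

lemma asym_part_remove:
  assumes "(a, b) \<in> asym_part R"
  shows "asym_part (R - {(a, b)}) = asym_part R - {(a, b)}" "sym_part (R - {(a, b)}) = sym_part R"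
  using assms by (auto simp: asym_part_def sym_part_def)

lemma asym_part_insert:
  assumes "(a, b) \<notin> R" "(b, a) \<notin> R" "a \<noteq> b"
  shows "asym_part (insert (a, b) R) = insert (a, b) (asym_part R)"
    "sym_part (insert (a, b) R) = sym_part R"
  using assms by (auto simp: asym_part_def sym_part_def)

lemma sym_part_Un_asym_part: "sym_part R \<union> asym_part R = R"
  by (auto simp: asym_part_def sym_part_def)

text \<open>The conclusion restores the hypothesis on symmetric parts, so the step can be iterated;
  the strict inclusion makes the iteration terminate.\<close>

lemma perturbation_step:
  assumes fin: "finite X" and R: "acyclic_order_on X R" and T: "acyclic_order_on X T"
    and ne: "R \<noteq> T" and sym: "sym_part R = sym_part T"
  shows "\<exists>R\<^sub>0. acyclic_order_on X R\<^sub>0 \<and> sym_part R\<^sub>0 = sym_part T \<and> one_step X R R\<^sub>0 T \<and>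
           sym_diff R\<^sub>0 T \<subset> sym_diff R T"
proof -
  let ?P = "asym_part R" and ?Q = "asym_part T"
  have RX: "R \<subseteq> X \<times> X" "refl_on X R" and TX: "T \<subseteq> X \<times> X" "refl_on X T"
    and X: "X \<noteq> {}" and acP: "acyclic ?P" and acQ: "acyclic ?Q"
    using R T by (auto simp: acyclic_order_on_def binary_relation_on_def acyclic_rel_on_iff)
  have order: "acyclic_order_on X R'"
    if "R' \<subseteq> X \<times> X" "refl_on X R'" "acyclic (asym_part R')" for R'
    using that X by (auto simp: acyclic_order_on_def binary_relation_on_def acyclic_rel_on_iff refl_on_def)
  have PX: "?P \<subseteq> X \<times> X" and QX: "?Q \<subseteq> X \<times> X"
    using RX TX by (auto simp: asym_part_def)
  define B where "B = {b. \<exists>a. ((a, b) \<in> ?P) \<noteq> ((a, b) \<in> ?Q)}"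
  have "?P \<noteq> ?Q" using ne sym sym_part_Un_asym_part by metis
  then obtain b0 where "b0 \<in> B" by (auto simp: B_def)
  \<comment> \<open>The transitive closure is used so that minimality of \<open>b\<close> excludes
    from \<open>B\<close> all points below \<open>b\<close>, not just its direct
    predecessors.\<close>
  moreover have "wf (?Q\<^sup>+)"
    using acQ fin QX finite_subset[OF QX] by (simp add: finite_acyclic_wf wf_trancl)
  ultimately obtain b where b: "b \<in> B" and below: "\<And>y. (y, b) \<in> ?Q\<^sup>+ \<Longrightarrow> y \<notin> B"
    by (metis wfE_min)
  show ?thesis
  proof (cases "\<forall>x. (x, b) \<in> ?Q \<longrightarrow> (x, b) \<in> ?P")
    case True
    then obtain a where a: "(a, b) \<in> ?P" "(a, b) \<notin> ?Q" using b by (auto simp: B_def)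
    then have ab: "a \<in> X" "b \<in> X" "(a, b) \<in> R" "(b, a) \<notin> R" "a \<noteq> b"
      using PX by (auto simp: asym_part_def)
    \<comment> \<open>Otherwise \<open>(a, b)\<close> would lie in \<open>sym_part T\<close>, hence
      in \<open>sym_part R\<close>, against \<open>(a, b) \<in> ?P\<close>.\<close>
    have nT: "(a, b) \<notin> T" using a sym sym_part_Un_asym_part[of T] by (auto simp: sym_part_def)
    let ?R = "ominus R a b"
    have "acyclic_order_on X ?R"
      unfolding ominus_def
      using RX ab acP asym_part_remove(1)[OF a(1)]
      by (intro order) (auto simp: refl_on_def intro: acyclic_subset)
    moreover have "sym_part ?R = sym_part T"
      using asym_part_remove(2)[OF a(1)] sym by (simp add: ominus_def)
    moreover have "one_step X R ?R T" using True a ab by (auto simp: one_step_def)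
    moreover have "sym_diff ?R T \<subset> sym_diff R T"
      using nT ab by (auto simp: ominus_def)
    ultimately show ?thesis by blast
  next
    case False
    then obtain a where a: "(a, b) \<in> ?Q" "(a, b) \<notin> ?P" by blast
    \<comment> \<open>The induction extends the path backwards from \<open>a\<close>. Each point
      \<open>z\<close> reached is below \<open>b\<close>, so \<open>z\<close> is not in
      \<open>B\<close> and an edge of \<open>?P\<close> into \<open>z\<close> is one of
      \<open>?Q\<close>.\<close>
    have Q_path: "(y, a) \<in> ?Q\<^sup>*" if "(y, a) \<in> ?P\<^sup>*" for y
      using that
    proof (induction rule: converse_rtrancl_induct)
      case (step y z)
      have "(z, b) \<in> ?Q\<^sup>+" using step.IH a(1) by (rule rtrancl_into_trancl1)
      then have "(y, z) \<in> ?Q" using below step.hyps(1) by (auto simp: B_def)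
      with step.IH show ?case by (rule converse_rtrancl_into_rtrancl[rotated])
    qed simp
    have nba: "(b, a) \<notin> ?P\<^sup>*"
    proof
      assume "(b, a) \<in> ?P\<^sup>*"
      then have "(b, b) \<in> ?Q\<^sup>+" using Q_path a(1) by (auto intro: rtrancl_into_trancl1)
      with acQ show False by (auto simp: acyclic_def)
    qed
    have ab: "a \<in> X" "b \<in> X" "(a, b) \<in> T" "(b, a) \<notin> T" "a \<noteq> b"
      using a QX by (auto simp: asym_part_def)
    have nP: "(b, a) \<notin> ?P" using nba by blast
    \<comment> \<open>A pair of \<open>R\<close> outside \<open>?P\<close> is symmetric in
      \<open>R\<close>, hence in \<open>T\<close>, which \<open>(a, b) \<in> ?Q\<close> forbids in
      either direction. So only the inserting case of \<open>oplus_candidate\<close> occurs.\<close>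
    have nR: "(a, b) \<notin> R" "(b, a) \<notin> R"
      using a nP sym ab sym_part_Un_asym_part[of R] by (auto simp: sym_part_def)
    let ?R = "insert (a, b) R"
    have ac: "acyclic (asym_part ?R)"
      using asym_part_insert(1)[OF nR ab(5)] acP nba by (simp add: acyclic_insert)
    have RX': "?R \<subseteq> X \<times> X" using RX ab by auto
    have cand: "oplus_candidate X R a b = ?R"
      using nR ab by (simp add: oplus_candidate_def Inc_def)
    then have "oplus X R a b = Some ?R"
      using ac acyclic_rel_on_iff[OF RX'] ab a nP by (simp add: oplus_def)
    then have "one_step X R ?R T" using a ab nP by (auto simp: one_step_def Inc_def)
    moreover have "acyclic_order_on X ?R"
      using RX' RX ac by (intro order) (auto simp: refl_on_def)
    moreover have "sym_part ?R = sym_part T"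
      using asym_part_insert(2)[OF nR ab(5)] sym by simp
    moreover have "sym_diff ?R T \<subset> sym_diff R T" using nR ab by auto
    ultimately show ?thesis by blast
  qed
qed

theorem theorem2p2:
  fixes X :: "'a set" and R T :: "'a rel"
  assumes "finite X" and "card X \<ge> 2"
    and "acyclic_order_on X R" and "acyclic_order_on X T"
    and "R \<noteq> T" and "sym_part R = sym_part T"
  shows "\<exists>(n::nat) (S :: nat \<Rightarrow> 'a rel).
           n > 0 \<and>
           (\<forall>k<n. acyclic_order_on X (S k)) \<and>
           one_step X R (S 0) T \<and>
           (\<forall>k\<in>{1..n - 1}. one_step X (S (k - 1)) (S k) T) \<and>
           S (n - 1) = T"
  using assms(3,5,6)
proof (induction "card (sym_diff R T)" arbitrary: R rule: less_induct)
  case less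
  obtain R\<^sub>0 where R0: "acyclic_order_on X R\<^sub>0" "sym_part R\<^sub>0 = sym_part T" "one_step X R R\<^sub>0 T"
    "sym_diff R\<^sub>0 T \<subset> sym_diff R T"
    using perturbation_step[OF assms(1) less.prems(1) assms(4) less.prems(2,3)] by blast
  show ?case
  proof (cases "R\<^sub>0 = T")
    case True
    \<comment> \<open>For \<open>n = 1\<close> the range \<open>{1..n - 1}\<close> is empty, so the
      first step is the only one.\<close>
    with R0 show ?thesis by (intro exI[of _ 1] exI[of _ "\<lambda>_. R\<^sub>0"]) auto
  next
    case False
    have "R \<subseteq> X \<times> X" "T \<subseteq> X \<times> X"
      using less.prems(1) assms(4) by (auto simp: acyclic_order_on_def binary_relation_on_def)
    then have "finite (sym_diff R T)"
      using assms(1) by (meson finite_Diff finite_SigmaI finite_UnI finite_subset)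
    then have "card (sym_diff R\<^sub>0 T) < card (sym_diff R T)"
      using R0(4) by (rule psubset_card_mono)
    from less.hyps[OF this R0(1) False R0(2)]
    obtain n :: nat and S :: "nat \<Rightarrow> 'a rel" where S: "n > 0" "\<forall>k<n. acyclic_order_on X (S k)" "one_step X R\<^sub>0 (S 0) T"
      "\<forall>k\<in>{1..n - 1}. one_step X (S (k - 1)) (S k) T" "S (n - 1) = T" by blast
    \<comment> \<open>Puts \<open>R\<^sub>0\<close> in front of \<open>S\<close>, shifting indices
      by one: link 1 is the first step out of \<open>R\<^sub>0\<close>, and link
      \<open>Suc j\<close> with \<open>j > 0\<close> is link \<open>j\<close> of
      \<open>S\<close>.\<close>
    let ?S = "case_nat R\<^sub>0 S"
    have "\<forall>k<Suc n. acyclic_order_on X (?S k)"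
      using S(2) R0(1) by (auto split: nat.split)
    moreover have "one_step X (?S (k - 1)) (?S k) T" if "k \<in> {1..Suc n - 1}" for k
    proof -
      from that obtain j where j: "k = Suc j" "j < n" by (cases k) auto
      show ?thesis
      proof (cases j)
        case 0
        with j S(3) show ?thesis by simp
      next
        case (Suc i)
        with j S(4)[rule_format, of j] show ?thesis by simp
      qed
    qed
    moreover have "?S (Suc n - 1) = T" using S(1,5) by (cases n) auto
    ultimately show ?thesis using R0(3) by (intro exI[of _ "Suc n"] exI[of _ ?S]) simp
  qed
qed

end
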